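(* Let $(P,e_P)$ be an $L$-ordered set. Then $(P^F,{\rm sub}_P)$ together with the mapping $\xi_P:P\to P^F$, $\xi_P(x)=co(1_x)$ (hull taken in $(P,\sigma^{\ast}(P))$), is an $L$-join-semilattice completion of $(P,e_P)$.
   Context: Throughout, $(L,\otimes)$ is a complete residuated lattice: $L$ is a complete lattice with bottom $0$ and top $1$, $(L,\otimes,1)$ is a commutative monoid, and $a\otimes\bigvee S=\bigvee_{s\in S}(a\otimes s)$; the operation $\to$ is determined by $a\otimes b\le c\iff a\le b\to c$. An $L$-subset of a set $X$ is a map $A:X\to L$; $L^X$ is the set of all of them, ordered pointwise, with pointwise joins, meets and $(a\to C)(x)=a\to C(x)$. $a_X$ is the constant $L$-subset with value $a$. $A$ is nonempty if $\bigvee_{x}A(x)=1$. $1_x\in L^X$ takes value $1$ at $x$ and $0$ elsewhere; $\chi_Z\in L^X$ takes value $1$ on $Z\subseteq X$ and $0$ off $Z$. ${\rm sub}_X(A,B)=\bigwedge_{x\in X}(A(x)\to B(x))$. A subset of a poset is directed if it is nonempty and any two of its elements have an upper bound in it; $\bigvee^{\uparrow}$ denotes the join of a directed family. $F\in L^X$ is finite if ${\rm sub}(F,\bigvee^{\uparrow}_{i}A_i)=\bigvee^{\uparrow}_i{\rm sub}(F,A_i)$ for every directed family $\{A_i\}\subseteq L^X$. For $f:X\to Y$, $f^{\rightarrow}(A)(y)=\bigvee_{f(x)=y}A(x)$. An $L$-order on $P$ is a map $e:P\times P\to L$ with $e(x,x)=1$; $e(x,y)\otimes e(y,z)\le e(x,z)$;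 and $e(x,y)\wedge e(y,x)=1$ implies $x=y$. Then $P=(P,e)$ is an $L$-ordered set. ${\downarrow}x(y)=e(y,x)$. $S\in L^P$ is a lower set if $S(x)\otimes e(y,x)\le S(y)$ for all $x,y$. An element $x$ is the supremum $\sqcup A$ of $A\in L^P$ if $e(x,y)={\rm sub}(A,{\downarrow}y)$ for all $y\in P$. $f:P\to Q$ is $L$-order-preserving if $e_P(x,y)\le e_Q(f(x),f(y))$ for all $x,y$. It is Scott convexity-preserving if it is $L$-order-preserving and for every nonempty finite $F\in L^P$ having a supremum, the supremum of $f^{\rightarrow}(F)$ exists and $f(\sqcup F)=\sqcup f^{\rightarrow}(F)$. $P$ is an $L$-join-semilattice if every nonempty finite $L$-subset of $P$ has a supremum. $L$-join-semilattice completion: for an $L$-join-semilattice $Q$ and a Scott convexity-preserving map $j:P\to Q$, $(Q,j)$ is an $L$-join-semilattice completion of $P$ if for every $L$-join-semilattice $M$ and Scott convexity-preserving map $f:P\to M$ there is a unique Scott convexity-preserving map $\overline f:Q\to M$ with $\overline f\circ j=f$. An $L$-convex structure on $X$ is a family $\mathcal C\subseteq L^X$ containing $0_X,1_X$, closed under joins of directed subsets and under arbitrary meets, and with $a\to C\in\mathcal C$ for all $a\in L$, $C\in\mathcal C$; $X=(X,\mathcal C(X))$ is an $L$-convex space, with convex sets the members of $\mathcal C(X)$ and hull operator $co_X(A)=\bigwedge\{B\in\mathcal C(X)\mid A\le B\}$. Scott $L$-convex structure: $\sigma^{\ast}(P)$ is the set of all lower sets $A\in L^P$ such that ${\rm sub}(F,A)\le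 A(\sqcup F)$ for every nonempty finite $F\in L^P$ whose supremum exists; it is an $L$-convex structure on $P$. Construction of $X^F$ for an $L$-convex space $X$: a convex set $K$ is compact if $\bigvee_xK(x)=1$ and ${\rm sub}(K,\bigvee^{\uparrow}_iC_i)=\bigvee^{\uparrow}_i{\rm sub}(K,C_i)$ for every directed family $\{C_i\}\subseteq\mathcal C(X)$. ${\rm cp}(\mathcal C(X))$ is the set of compact convex sets; for $A\in\mathcal C(X)$, $\phi(A)(K)={\rm sub}(K,A)$ for $K\in{\rm cp}(\mathcal C(X))$. ${\rm Cp}(\mathcal C(X))$ is the set ${\rm cp}(\mathcal C(X))$ with $L$-convex structure $\{\phi(A)\mid A\in\mathcal C(X)\}$. A subset $A$ of an $L$-convex space $Y$ is F-closed if for every nonempty finite $F\in L^Y$ and $y\in Y$, $F\le\chi_A$ and $co_Y(F)=co_Y(1_y)$ imply $y\in A$; the F-closure of a subset is the intersection of all F-closed sets containing it. $X^F$ is the F-closure of $\{co_X(1_x)\mid x\in X\}$ in ${\rm Cp}(\mathcal C(X))$. $P^F$ denotes $X^F$ for $X=(P,\sigma^{\ast}(P))$; it is a set of $L$-subsets of $P$, and as an $L$-ordered set it carries the inclusion $L$-order ${\rm sub}_P$. *)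

theory Defs
  imports Main "HOL-Library.FuncSet"
begin

class complete_residuated_lattice = complete_lattice + comm_monoid_mult +
  assumes one_eq_top: "1 = top"
    and mult_Sup: "a * Sup S = Sup ((*) a ` S)"

definition residuum :: "'l::complete_residuated_lattice \<Rightarrow> 'l \<Rightarrow> 'l" (infixr "\<leadsto>" 65)
  where "b \<leadsto> c = Sup {a. a * b \<le> c}"

lemma residuum_adjoint:
  fixes a b c :: "'l::complete_residuated_lattice"
  shows "a * b \<le> c \<longleftrightarrow> a \<le> b \<leadsto> c"
proof
  assume "a * b \<le> c"
  then show "a \<le> b \<leadsto> c" unfolding residuum_def by (auto intro: Sup_upper)
next
  have mono: "b * x \<le> b * y" if "x \<le> y" for x y
    using mult_Sup[of b "{x, y}"] that by (simp add: sup.absorb2 le_iff_sup)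
  have "b * (b \<leadsto> c) \<le> c"
    unfolding residuum_def mult_Sup by (auto intro!: Sup_least simp: mult.commute)
  moreover assume "a \<le> b \<leadsto> c"
  ultimately show "a * b \<le> c"
    using mono[of a "b \<leadsto> c"] by (simp add: mult.commute)
qed


section \<open>L-subsets\<close>

text \<open>
  Spaces and ordered sets have explicit carriers. A map \<open>X \<rightarrow> L\<close> is represented by a member of
  \<open>extensional X\<close>, so that equality of L-subsets is equality of functions; on these functions the
  library order \<open>\<le>\<close> is the pointwise order on \<open>X\<close>.
\<close>

definition Lsubsets :: "'a set \<Rightarrow> ('a \<Rightarrow> 'l::complete_residuated_lattice) set"
  where "Lsubsets X = X \<rightarrow>\<^sub>E UNIV"

definition Lconst :: "'a set \<Rightarrow> 'l \<Rightarrow> 'a \<Rightarrow> 'l::complete_residuated_lattice"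
  where "Lconst X a = (\<lambda>x\<in>X. a)"

definition char_Lsubset :: "'a set \<Rightarrow> 'a set \<Rightarrow> 'a \<Rightarrow> 'l::complete_residuated_lattice"
  where "char_Lsubset X Z = (\<lambda>x\<in>X. if x \<in> Z then 1 else bot)"

abbreviation point_Lsubset :: "'a set \<Rightarrow> 'a \<Rightarrow> 'a \<Rightarrow> 'l::complete_residuated_lattice"
  where "point_Lsubset X x \<equiv> char_Lsubset X {x}"

definition Ljoin :: "'a set \<Rightarrow> ('a \<Rightarrow> 'l) set \<Rightarrow> 'a \<Rightarrow> 'l::complete_residuated_lattice"
  where "Ljoin X S = (\<lambda>x\<in>X. SUP A\<in>S. A x)"

definition Lmeet :: "'a set \<Rightarrow> ('a \<Rightarrow> 'l) set \<Rightarrow> 'a \<Rightarrow> 'l::complete_residuated_lattice"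
  where "Lmeet X S = (\<lambda>x\<in>X. INF A\<in>S. A x)"

definition Lcotensor :: "'a set \<Rightarrow> 'l \<Rightarrow> ('a \<Rightarrow> 'l) \<Rightarrow> 'a \<Rightarrow> 'l::complete_residuated_lattice"
  where "Lcotensor X a C = (\<lambda>x\<in>X. a \<leadsto> C x)"

definition sub :: "'a set \<Rightarrow> ('a \<Rightarrow> 'l) \<Rightarrow> ('a \<Rightarrow> 'l) \<Rightarrow> 'l::complete_residuated_lattice"
  where "sub X A B = (INF x\<in>X. A x \<leadsto> B x)"

definition Lnonempty :: "'a set \<Rightarrow> ('a \<Rightarrow> 'l::complete_residuated_lattice) \<Rightarrow> bool"
  where "Lnonempty X A \<longleftrightarrow> (SUP x\<in>X. A x) = 1"

definition directed :: "'b::order set \<Rightarrow> bool"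
  where "directed D \<longleftrightarrow> D \<noteq> {} \<and> (\<forall>x\<in>D. \<forall>y\<in>D. \<exists>z\<in>D. x \<le> z \<and> y \<le> z)"

definition Lfinite :: "'a set \<Rightarrow> ('a \<Rightarrow> 'l::complete_residuated_lattice) \<Rightarrow> bool"
  where "Lfinite X F \<longleftrightarrow> F \<in> Lsubsets X \<and>
    (\<forall>D. D \<subseteq> Lsubsets X \<and> directed D \<longrightarrow> sub X F (Ljoin X D) = (SUP A\<in>D. sub X F A))"

definition Limage ::
    "'a set \<Rightarrow> 'b set \<Rightarrow> ('a \<Rightarrow> 'b) \<Rightarrow> ('a \<Rightarrow> 'l) \<Rightarrow> 'b \<Rightarrow> 'l::complete_residuated_lattice"
  where "Limage X Y f A = (\<lambda>y\<in>Y. SUP x\<in>{x\<in>X. f x = y}. A x)"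


section \<open>L-ordered sets\<close>

definition Lordered_set :: "'a set \<Rightarrow> ('a \<Rightarrow> 'a \<Rightarrow> 'l::complete_residuated_lattice) \<Rightarrow> bool"
  where "Lordered_set P e \<longleftrightarrow>
    (\<forall>x\<in>P. e x x = 1) \<and>
    (\<forall>x\<in>P. \<forall>y\<in>P. \<forall>z\<in>P. e x y * e y z \<le> e x z) \<and>
    (\<forall>x\<in>P. \<forall>y\<in>P. inf (e x y) (e y x) = 1 \<longrightarrow> x = y)"

definition down ::
    "'a set \<Rightarrow> ('a \<Rightarrow> 'a \<Rightarrow> 'l) \<Rightarrow> 'a \<Rightarrow> 'a \<Rightarrow> 'l::complete_residuated_lattice"
  where "down P e x = (\<lambda>y\<in>P. e y x)"

definition lower_Lset ::
    "'a set \<Rightarrow> ('a \<Rightarrow> 'a \<Rightarrow> 'l) \<Rightarrow> ('a \<Rightarrow> 'l::complete_residuated_lattice) \<Rightarrow> bool"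
  where "lower_Lset P e S \<longleftrightarrow> S \<in> Lsubsets P \<and> (\<forall>x\<in>P. \<forall>y\<in>P. S x * e y x \<le> S y)"

definition is_Lsup ::
    "'a set \<Rightarrow> ('a \<Rightarrow> 'a \<Rightarrow> 'l) \<Rightarrow> ('a \<Rightarrow> 'l::complete_residuated_lattice) \<Rightarrow> 'a \<Rightarrow> bool"
  where "is_Lsup P e A x \<longleftrightarrow> x \<in> P \<and> (\<forall>y\<in>P. e x y = sub P A (down P e y))"

lemma is_Lsup_unique:
  assumes "Lordered_set P e" "is_Lsup P e A x" "is_Lsup P e A y"
  shows "x = y"
proof -
  have "e x y = e y y" "e y x = e x x" "x \<in> P" "y \<in> P"
    using assms(2,3) unfolding is_Lsup_def by auto
  then show ?thesis using assms(1) unfolding Lordered_set_def by auto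
qed

definition Lorder_preserving ::
    "'a set \<Rightarrow> ('a \<Rightarrow> 'a \<Rightarrow> 'l::complete_residuated_lattice) \<Rightarrow>
     'b set \<Rightarrow> ('b \<Rightarrow> 'b \<Rightarrow> 'l) \<Rightarrow> ('a \<Rightarrow> 'b) \<Rightarrow> bool"
  where "Lorder_preserving P eP Q eQ f \<longleftrightarrow>
    f \<in> P \<rightarrow> Q \<and> (\<forall>x\<in>P. \<forall>y\<in>P. eP x y \<le> eQ (f x) (f y))"

definition Scott_convexity_preserving ::
    "'a set \<Rightarrow> ('a \<Rightarrow> 'a \<Rightarrow> 'l::complete_residuated_lattice) \<Rightarrow>
     'b set \<Rightarrow> ('b \<Rightarrow> 'b \<Rightarrow> 'l) \<Rightarrow> ('a \<Rightarrow> 'b) \<Rightarrow> bool"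
  where "Scott_convexity_preserving P eP Q eQ f \<longleftrightarrow>
    Lorder_preserving P eP Q eQ f \<and>
    (\<forall>F s. Lnonempty P F \<and> Lfinite P F \<and> is_Lsup P eP F s \<longrightarrow>
       is_Lsup Q eQ (Limage P Q f F) (f s))"

definition Ljoin_semilattice :: "'a set \<Rightarrow> ('a \<Rightarrow> 'a \<Rightarrow> 'l::complete_residuated_lattice) \<Rightarrow> bool"
  where "Ljoin_semilattice P e \<longleftrightarrow> Lordered_set P e \<and>
    (\<forall>F. Lnonempty P F \<and> Lfinite P F \<longrightarrow> (\<exists>s. is_Lsup P e F s))"

text \<open>
  The universal property ranges over all L-join-semilattices \<open>M\<close> with carrier in the type given by
  the first argument; HOL cannot quantify over types inside a formula, so a statement for arbitrary
  \<open>M\<close> leaves \<open>'m\<close> a free type variable. A map out of \<open>Q\<close> is determined by its values on \<open>Q\<close> only,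
  hence uniqueness is stated for functions in \<open>extensional Q\<close>.
\<close>

definition Ljoin_semilattice_completion ::
    "'m itself \<Rightarrow> 'a set \<Rightarrow> ('a \<Rightarrow> 'a \<Rightarrow> 'l::complete_residuated_lattice) \<Rightarrow>
     'q set \<Rightarrow> ('q \<Rightarrow> 'q \<Rightarrow> 'l) \<Rightarrow> ('a \<Rightarrow> 'q) \<Rightarrow> bool"
  where "Ljoin_semilattice_completion (_ :: 'm itself) P eP Q eQ j \<longleftrightarrow>
    Ljoin_semilattice Q eQ \<and>
    Scott_convexity_preserving P eP Q eQ j \<and>
    (\<forall>(M :: 'm set) eM f.
       Ljoin_semilattice M eM \<and> Scott_convexity_preserving P eP M eM f \<longrightarrow>
       (\<exists>!g. g \<in> extensional Q \<and> Scott_convexity_preserving Q eQ M eM g \<and>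
             (\<forall>x\<in>P. g (j x) = f x)))"


section \<open>L-convex spaces\<close>

definition Lconvex_structure :: "'a set \<Rightarrow> ('a \<Rightarrow> 'l::complete_residuated_lattice) set \<Rightarrow> bool"
  where "Lconvex_structure X \<C> \<longleftrightarrow>
    \<C> \<subseteq> Lsubsets X \<and> Lconst X bot \<in> \<C> \<and> Lconst X 1 \<in> \<C> \<and>
    (\<forall>D. D \<subseteq> \<C> \<and> directed D \<longrightarrow> Ljoin X D \<in> \<C>) \<and>
    (\<forall>S. S \<subseteq> \<C> \<longrightarrow> Lmeet X S \<in> \<C>) \<and>
    (\<forall>a. \<forall>C\<in>\<C>. Lcotensor X a C \<in> \<C>)"

definition hull ::
    "'a set \<Rightarrow> ('a \<Rightarrow> 'l) set \<Rightarrow> ('a \<Rightarrow> 'l) \<Rightarrow> 'a \<Rightarrow> 'l::complete_residuated_lattice"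
  where "hull X \<C> A = Lmeet X {B \<in> \<C>. A \<le> B}"

definition Scott_Lconvex ::
    "'a set \<Rightarrow> ('a \<Rightarrow> 'a \<Rightarrow> 'l) \<Rightarrow> ('a \<Rightarrow> 'l::complete_residuated_lattice) set"
  where "Scott_Lconvex P e = {A. lower_Lset P e A \<and>
    (\<forall>F s. Lnonempty P F \<and> Lfinite P F \<and> is_Lsup P e F s \<longrightarrow> sub P F A \<le> A s)}"

lemma Scott_Lconvex_is_structure:
  fixes P :: "'a set" and e :: "'a \<Rightarrow> 'a \<Rightarrow> 'l::complete_residuated_lattice"
  shows "Lconvex_structure P (Scott_Lconvex P e)"
proof -
  have mono: "a * b \<le> a' * b" if "a \<le> a'" for a a' b :: 'l
    using order_trans[OF that iffD1[OF residuum_adjoint order_refl]] by (simp only: residuum_adjoint)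
  have mp: "a * (a \<leadsto> b) \<le> b" for a b :: 'l
    using residuum_adjoint[of "a \<leadsto> b" a b] by (simp add: mult.commute)
  have le_sub: "a \<le> sub P F A \<longleftrightarrow> (\<forall>x\<in>P. a * F x \<le> A x)" for a F A
    by (simp add: sub_def le_INF_iff residuum_adjoint)
  have sub_mono: "sub P F A \<le> sub P F B" if "\<And>x. x \<in> P \<Longrightarrow> A x \<le> B x" for F A B
    using le_sub[of "sub P F A" F A] le_sub[of "sub P F A" F B] order_trans[OF _ that] by simp
  have mem: "A \<in> Scott_Lconvex P e \<longleftrightarrow> A \<in> Lsubsets P \<and>
      (\<forall>x\<in>P. \<forall>y\<in>P. A x * e y x \<le> A y) \<and>
      (\<forall>F s. Lnonempty P F \<and> Lfinite P F \<and> is_Lsup P e F s \<longrightarrow> sub P F A \<le> A s)" for A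
    by (auto simp: Scott_Lconvex_def lower_Lset_def)
  have le1: "a \<le> 1" for a :: 'l by (simp add: one_eq_top)
  have bot: "bot * a = bot" for a :: 'l
    using mult_Sup[of a "{}"] by (simp add: mult.commute)
  have sub_bot: "sub P F (Lconst P bot) = bot" if "Lnonempty P F" for F :: "'a \<Rightarrow> 'l"
  proof -
    let ?s = "sub P F (Lconst P bot)"
    have "?s = ?s * (SUP x\<in>P. F x)" using that by (simp add: Lnonempty_def)
    also have "\<dots> = (SUP x\<in>P. ?s * F x)" by (simp add: mult_Sup image_image)
    also have "\<dots> \<le> bot"
      using le_sub[of ?s F "Lconst P bot"] by (intro SUP_least) (auto simp: Lconst_def)
    finally show ?thesis by (simp add: bot_unique)
  qed
  have sP: "is_Lsup P e F s \<Longrightarrow> s \<in> P" for F s by (simp add: is_Lsup_def)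
  show ?thesis unfolding Lconvex_structure_def
  proof (intro conjI allI impI ballI)
    show "Scott_Lconvex P e \<subseteq> Lsubsets P" using mem by blast
    show "Lconst P bot \<in> Scott_Lconvex P e" unfolding mem
      by (auto simp: sub_bot bot) (auto simp: Lconst_def Lsubsets_def bot)
    show "Lconst P 1 \<in> Scott_Lconvex P e" unfolding mem
      by (auto simp: Lconst_def Lsubsets_def le1 sP)
  next
    fix D assume D: "D \<subseteq> Scott_Lconvex P e \<and> directed D"
    then have DL: "D \<subseteq> Lsubsets P" using mem by blast
    show "Ljoin P D \<in> Scott_Lconvex P e" unfolding mem
    proof (intro conjI ballI allI impI)
      show "Ljoin P D \<in> Lsubsets P" by (auto simp: Ljoin_def Lsubsets_def)
    next
      fix x y assume xy: "x \<in> P" "y \<in> P"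
      have "(SUP A\<in>D. A x) * e y x = (SUP A\<in>D. e y x * A x)"
        by (simp add: mult.commute[of _ "e y x"] mult_Sup image_image)
      also have "\<dots> \<le> (SUP A\<in>D. A y)"
      proof (rule SUP_mono)
        fix A assume "A \<in> D"
        then have "A \<in> D \<and> e y x * A x \<le> A y" using D mem xy by (auto simp: mult.commute)
        then show "\<exists>B\<in>D. e y x * A x \<le> B y" by blast
      qed
      finally show "Ljoin P D x * e y x \<le> Ljoin P D y" using xy by (simp add: Ljoin_def)
    next
      fix F s assume F: "Lnonempty P F \<and> Lfinite P F \<and> is_Lsup P e F s"
      then have s: "s \<in> P" using sP by blast
      have "sub P F (Ljoin P D) = (SUP A\<in>D. sub P F A)"
        using D DL F unfolding Lfinite_def by blast
      also have "\<dots> \<le> (SUP A\<in>D. A s)" using D mem F by (intro SUP_mono) blast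
      finally show "sub P F (Ljoin P D) \<le> Ljoin P D s" using s by (simp add: Ljoin_def)
    qed
  next
    fix S assume S: "S \<subseteq> Scott_Lconvex P e"
    show "Lmeet P S \<in> Scott_Lconvex P e" unfolding mem
    proof (intro conjI ballI allI impI)
      show "Lmeet P S \<in> Lsubsets P" by (auto simp: Lmeet_def Lsubsets_def)
    next
      fix x y assume xy: "x \<in> P" "y \<in> P"
      have "(INF A\<in>S. A x) * e y x \<le> A y" if "A \<in> S" for A
      proof -
        have "(INF A\<in>S. A x) * e y x \<le> A x * e y x" using that by (intro mono INF_lower)
        also have "\<dots> \<le> A y" using S mem xy that by blast
        finally show ?thesis .
      qed
      then show "Lmeet P S x * e y x \<le> Lmeet P S y" using xy by (auto simp: Lmeet_def le_INF_iff)
    next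
      fix F s assume F: "Lnonempty P F \<and> Lfinite P F \<and> is_Lsup P e F s"
      then have s: "s \<in> P" using sP by blast
      have "sub P F (Lmeet P S) \<le> A s" if "A \<in> S" for A
      proof -
        have "sub P F (Lmeet P S) \<le> sub P F A"
          using that by (intro sub_mono) (auto simp: Lmeet_def intro: INF_lower)
        also have "\<dots> \<le> A s" using S mem F that by blast
        finally show ?thesis .
      qed
      then show "sub P F (Lmeet P S) \<le> Lmeet P S s"
        using s by (auto simp: Lmeet_def le_INF_iff)
    qed
  next
    fix a C assume C: "C \<in> Scott_Lconvex P e"
    show "Lcotensor P a C \<in> Scott_Lconvex P e" unfolding mem
    proof (intro conjI ballI allI impI)
      show "Lcotensor P a C \<in> Lsubsets P" by (auto simp: Lcotensor_def Lsubsets_def)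
    next
      fix x y assume xy: "x \<in> P" "y \<in> P"
      have "(a \<leadsto> C x) * e y x * a \<le> C x * e y x"
        using mono[OF mp[of a "C x"], of "e y x"] by (simp add: ac_simps)
      also have "\<dots> \<le> C y" using C mem xy by blast
      finally show "Lcotensor P a C x * e y x \<le> Lcotensor P a C y"
        using xy by (simp add: Lcotensor_def residuum_adjoint)
    next
      fix F s assume F: "Lnonempty P F \<and> Lfinite P F \<and> is_Lsup P e F s"
      then have s: "s \<in> P" using sP by blast
      let ?s = "sub P F (Lcotensor P a C)"
      have "?s * F x * a \<le> C x" if "x \<in> P" for x
        using le_sub[of ?s F "Lcotensor P a C"] that by (simp add: Lcotensor_def residuum_adjoint)
      then have "?s * a \<le> sub P F C" by (simp add: le_sub ac_simps)
      also have "\<dots> \<le> C s" using C mem F by blast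
      finally show "?s \<le> Lcotensor P a C s"
        using s by (simp add: Lcotensor_def residuum_adjoint)
    qed
  qed
qed

definition cp :: "'a set \<Rightarrow> ('a \<Rightarrow> 'l) set \<Rightarrow> ('a \<Rightarrow> 'l::complete_residuated_lattice) set"
  where "cp X \<C> = {K \<in> \<C>. Lnonempty X K \<and>
    (\<forall>D. D \<subseteq> \<C> \<and> directed D \<longrightarrow> sub X K (Ljoin X D) = (SUP C\<in>D. sub X K C))}"

definition phi ::
    "'a set \<Rightarrow> ('a \<Rightarrow> 'l) set \<Rightarrow> ('a \<Rightarrow> 'l) \<Rightarrow> ('a \<Rightarrow> 'l) \<Rightarrow> 'l::complete_residuated_lattice"
  where "phi X \<C> A = (\<lambda>K\<in>cp X \<C>. sub X K A)"

definition Cp_structure ::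
    "'a set \<Rightarrow> ('a \<Rightarrow> 'l) set \<Rightarrow> (('a \<Rightarrow> 'l) \<Rightarrow> 'l::complete_residuated_lattice) set"
  where "Cp_structure X \<C> = phi X \<C> ` \<C>"

definition F_closed ::
    "'a set \<Rightarrow> ('a \<Rightarrow> 'l::complete_residuated_lattice) set \<Rightarrow> 'a set \<Rightarrow> bool"
  where "F_closed Y \<C> A \<longleftrightarrow> A \<subseteq> Y \<and>
    (\<forall>F. \<forall>y\<in>Y. Lnonempty Y F \<and> Lfinite Y F \<and> F \<le> char_Lsubset Y A \<and>
       hull Y \<C> F = hull Y \<C> (point_Lsubset Y y) \<longrightarrow> y \<in> A)"

definition F_closure ::
    "'a set \<Rightarrow> ('a \<Rightarrow> 'l::complete_residuated_lattice) set \<Rightarrow> 'a set \<Rightarrow> 'a set"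
  where "F_closure Y \<C> Z = \<Inter>{A. F_closed Y \<C> A \<and> Z \<subseteq> A}"

definition F_completion ::
    "'a set \<Rightarrow> ('a \<Rightarrow> 'l) set \<Rightarrow> ('a \<Rightarrow> 'l::complete_residuated_lattice) set"
  where "F_completion X \<C> =
    F_closure (cp X \<C>) (Cp_structure X \<C>) ((\<lambda>x. hull X \<C> (point_Lsubset X x)) ` X)"

definition PF ::
    "'a set \<Rightarrow> ('a \<Rightarrow> 'a \<Rightarrow> 'l) \<Rightarrow> ('a \<Rightarrow> 'l::complete_residuated_lattice) set"
  where "PF P e = F_completion P (Scott_Lconvex P e)"

definition xi ::
    "'a set \<Rightarrow> ('a \<Rightarrow> 'a \<Rightarrow> 'l) \<Rightarrow> 'a \<Rightarrow> 'a \<Rightarrow> 'l::complete_residuated_lattice"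
  where "xi P e x = hull P (Scott_Lconvex P e) (point_Lsubset P x)"

end

theory Submission
  imports Defs
begin

text \<open>
  For a nonempty finite \<open>F\<close> on the compact convex sets and a compact convex set \<open>K\<close>, the equality
  \<open>co F = co 1\<^sub>K\<close> says that \<open>sub K A = \<And>\<^sub>K\<^sub>' (F K' \<leadsto> sub K' A)\<close> for all convex \<open>A\<close>, i.e. that \<open>K\<close> is
  the supremum of \<open>F\<close> among the convex sets. So \<open>P\<^sup>F\<close> is the closure of the sets \<open>\<xi> x\<close> under such
  suprema, which makes it a join-semilattice and makes maps out of it unique. A Scott
  convexity-preserving \<open>f : P \<rightarrow> M\<close> pulls every principal ideal back to a Scott convex set, and its
  extension sends \<open>K\<close> to the element \<open>m\<close> with \<open>e m z = sub K (e (f _) z)\<close>; the sets \<open>K\<close> for which such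
  an \<open>m\<close> exists contain all \<open>\<xi> x\<close> and are closed under the same suprema.
\<close>

section \<open>Residuated lattices and L-subsets\<close>

lemma mult_SUP:
  fixes a :: "'l::complete_residuated_lattice"
  shows "a * (SUP i\<in>I. f i) = (SUP i\<in>I. a * f i)"
  by (simp add: mult_Sup image_image)

lemma mult_mono_left:
  fixes a b :: "'l::complete_residuated_lattice"
  assumes "a \<le> b"
  shows "a * c \<le> b * c"
  using order_trans[OF assms iffD1[OF residuum_adjoint order_refl]] by (simp only: residuum_adjoint)

lemma mult_mono_right:
  fixes a b :: "'l::complete_residuated_lattice"
  assumes "a \<le> b"
  shows "c * a \<le> c * b"
  using mult_mono_left[OF assms, of c] by (simp add: mult.commute)

lemma le_one: "(a :: 'l::complete_residuated_lattice) \<le> 1"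
  by (simp add: one_eq_top)

lemma one_le_iff: "(1 :: 'l::complete_residuated_lattice) \<le> a \<longleftrightarrow> a = 1"
  using le_one antisym by blast

lemma mult_bot: "a * bot = (bot :: 'l::complete_residuated_lattice)"
  using mult_Sup[of a "{}"] by simp

lemma le_sub_iff: "a \<le> sub X F A \<longleftrightarrow> (\<forall>x\<in>X. a * F x \<le> A x)"
  by (simp add: sub_def le_INF_iff residuum_adjoint)

lemma sub_mult_le: "x \<in> X \<Longrightarrow> sub X F A * F x \<le> A x"
  using le_sub_iff[of "sub X F A" X F A] by simp

text \<open>Since \<open>sub\<close> is an infimum of residua, its lower bounds are cut out by
  multiplicative inequalities. Comparing these avoids residua, and the two carriers may
  differ.\<close>

lemma sub_eqI:
  assumes "\<And>a. (\<forall>x\<in>X. a * F x \<le> A x) \<longleftrightarrow> (\<forall>y\<in>Y. a * G y \<le> B y)"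
  shows "sub X F A = sub Y G B"
proof -
  have "a \<le> sub X F A \<longleftrightarrow> a \<le> sub Y G B" for a using assms by (simp only: le_sub_iff)
  then show ?thesis by (meson antisym order_refl)
qed

lemma sub_cong:
  assumes "\<And>x. x \<in> X \<Longrightarrow> F x = G x" "\<And>x. x \<in> X \<Longrightarrow> A x = B x"
  shows "sub X F A = sub X G B"
  using assms by (simp add: sub_def)

lemma sub_eq_one_iff: "sub X F A = 1 \<longleftrightarrow> (\<forall>x\<in>X. F x \<le> A x)"
  using le_sub_iff[of 1 X F A] one_le_iff[of "sub X F A"] by simp

lemma Lsubset_le_iff:
  assumes "A \<in> Lsubsets X" "B \<in> Lsubsets X"
  shows "A \<le> B \<longleftrightarrow> (\<forall>x\<in>X. A x \<le> B x)"
proof -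
  have "A x = B x" if "x \<notin> X" for x
    using assms that by (auto simp: Lsubsets_def PiE_def extensional_def)
  then show ?thesis by (metis le_fun_def order_refl)
qed

lemma sub_eq_one_iff_le:
  assumes "A \<in> Lsubsets X" "B \<in> Lsubsets X"
  shows "sub X A B = 1 \<longleftrightarrow> A \<le> B"
  using assms by (simp add: sub_eq_one_iff Lsubset_le_iff)

lemma sub_trans: "sub X A B * sub X B C \<le> sub X A C"
proof -
  have "sub X A B * sub X B C * A x \<le> C x" if "x \<in> X" for x
  proof -
    have 1: "sub X A B * A x \<le> B x" "sub X B C * B x \<le> C x"
      using that by (simp_all add: sub_mult_le)
    have "sub X A B * sub X B C * A x = sub X B C * (sub X A B * A x)"
      by (simp add: ac_simps)
    also have "\<dots> \<le> C x" using order_trans[OF mult_mono_right[OF 1(1)] 1(2)] .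
    finally show ?thesis .
  qed
  then show ?thesis by (simp add: le_sub_iff)
qed

lemma Lordered_set_sub:
  assumes "Q \<subseteq> Lsubsets X"
  shows "Lordered_set Q (sub X)"
  unfolding Lordered_set_def
proof (intro conjI ballI impI)
  show "sub X A A = 1" for A :: "'a \<Rightarrow> 'b" by (simp add: sub_eq_one_iff)
  show "sub X A B * sub X B C \<le> sub X A C" for A B C :: "'a \<Rightarrow> 'b" by (rule sub_trans)
  fix A B assume AB: "A \<in> Q" "B \<in> Q" and "inf (sub X A B) (sub X B A) = 1"
  then have "sub X A B = 1" "sub X B A = 1" by (metis one_le_iff inf.cobounded1 inf.cobounded2)+
  then show "A = B" using AB assms sub_eq_one_iff_le by (meson antisym subset_iff)
qed

lemma directed_image:
  assumes "directed D" "\<And>A B. A \<in> D \<Longrightarrow> B \<in> D \<Longrightarrow> A \<le> B \<Longrightarrow> f A \<le> f B"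
  shows "directed (f ` D)"
  using assms unfolding directed_def by (simp add: image_iff) metis

section \<open>Nonempty finite L-subsets: images, restrictions, points\<close>

lemma char_in_Lsubsets: "char_Lsubset X Z \<in> Lsubsets X"
  by (auto simp: char_Lsubset_def Lsubsets_def)

lemma Limage_in_Lsubsets: "Limage X Y f F \<in> Lsubsets Y"
  by (simp add: Limage_def Lsubsets_def)

text \<open>Change of variables: multiplication distributes over the join taken on each fibre of
  \<open>f\<close>, so bounding the image is bounding every \<open>F x\<close> separately.\<close>

lemma sub_Limage:
  assumes "f \<in> X \<rightarrow> Y"
  shows "sub Y (Limage X Y f F) B = sub X F (\<lambda>x. B (f x))"
proof (rule sub_eqI)
  fix a
  show "(\<forall>y\<in>Y. a * Limage X Y f F y \<le> B y) \<longleftrightarrow> (\<forall>x\<in>X. a * F x \<le> B (f x))"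
    using assms by (auto simp: Limage_def mult_SUP SUP_le_iff)
qed

lemma SUP_Limage:
  assumes "f \<in> X \<rightarrow> Y"
  shows "(SUP y\<in>Y. Limage X Y f F y) = (SUP x\<in>X. F x)"
proof (rule antisym)
  show "(SUP y\<in>Y. Limage X Y f F y) \<le> (SUP x\<in>X. F x)"
    by (auto simp: Limage_def intro!: SUP_least intro: SUP_upper)
  have "F x \<le> (SUP y\<in>Y. Limage X Y f F y)" if "x \<in> X" for x
  proof -
    have "F x \<le> Limage X Y f F (f x)"
      using that assms by (auto simp: Limage_def intro!: SUP_upper)
    also have "\<dots> \<le> (SUP y\<in>Y. Limage X Y f F y)" using that assms by (auto intro!: SUP_upper)
    finally show ?thesis .
  qed
  then show "(SUP x\<in>X. F x) \<le> (SUP y\<in>Y. Limage X Y f F y)" by (rule SUP_least)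
qed

lemma Lnonempty_Limage:
  assumes "f \<in> X \<rightarrow> Y" "Lnonempty X F"
  shows "Lnonempty Y (Limage X Y f F)"
  using assms by (simp add: Lnonempty_def SUP_Limage)

text \<open>By \<open>sub_Limage\<close>, testing the image against \<open>A\<close> is testing
  \<open>F\<close> against \<open>A\<close> composed with \<open>f\<close>. Composing with
  \<open>f\<close> keeps directedness and pointwise joins, so finiteness of \<open>F\<close>
  applies.\<close>

lemma Lfinite_Limage:
  assumes f: "f \<in> X \<rightarrow> Y" and F: "Lfinite X F"
  shows "Lfinite Y (Limage X Y f F)"
  unfolding Lfinite_def
proof (intro conjI allI impI, rule Limage_in_Lsubsets)
  fix D :: "('b \<Rightarrow> 'c) set"
  assume D: "D \<subseteq> Lsubsets Y \<and> directed D"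
  define pull where "pull A = (\<lambda>x\<in>X. A (f x))" for A :: "'b \<Rightarrow> 'c"
  have "directed (pull ` D)"
    using D by (intro directed_image) (auto simp: pull_def le_fun_def)
  moreover have "pull ` D \<subseteq> Lsubsets X" by (auto simp: pull_def Lsubsets_def)
  ultimately have "sub X F (Ljoin X (pull ` D)) = (SUP A\<in>pull ` D. sub X F A)"
    using F unfolding Lfinite_def by blast
  also have "\<dots> = (SUP A\<in>D. sub Y (Limage X Y f F) A)"
    unfolding sub_Limage[OF f] image_image
    by (intro SUP_cong refl sub_cong) (auto simp: pull_def)
  also have "sub X F (Ljoin X (pull ` D)) = sub Y (Limage X Y f F) (Ljoin Y D)"
    unfolding sub_Limage[OF f] using f
    by (intro sub_cong) (auto simp: Ljoin_def pull_def image_image)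
  finally show "sub Y (Limage X Y f F) (Ljoin Y D) = (SUP A\<in>D. sub Y (Limage X Y f F) A)" .
qed

lemma Limage_inclusion_le_char:
  assumes "Q \<subseteq> Y"
  shows "Limage Q Y (\<lambda>x. x) F \<le> char_Lsubset Y Q"
proof -
  have "Limage Q Y (\<lambda>x. x) F y \<le> char_Lsubset Y Q y" if "y \<in> Y" for y
    using that by (auto simp: Limage_def char_Lsubset_def le_one intro: SUP_least)
  then show ?thesis by (simp add: Lsubset_le_iff[OF Limage_in_Lsubsets char_in_Lsubsets])
qed

lemma le_char_bot:
  assumes "F \<le> char_Lsubset Y Q" "y \<in> Y" "y \<notin> Q"
  shows "F y = bot"
  using le_funD[OF assms(1), of y] assms(2,3) by (simp add: char_Lsubset_def bot_unique)

text \<open>Off \<open>Q\<close> the values of \<open>F\<close> are bottom and impose no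
  condition.\<close>

lemma sub_restrict:
  assumes "F \<le> char_Lsubset Y Q" "Q \<subseteq> Y"
  shows "sub Q (restrict F Q) B = sub Y F B"
proof (rule sub_eqI)
  fix a
  have "a * F y \<le> B y" if "y \<in> Y" "y \<notin> Q" for y
    using le_char_bot[OF assms(1) that] by (simp add: mult_bot)
  then show "(\<forall>x\<in>Q. a * restrict F Q x \<le> B x) \<longleftrightarrow> (\<forall>y\<in>Y. a * F y \<le> B y)"
    using assms(2) by auto
qed

lemma Lnonempty_restrict:
  assumes "F \<le> char_Lsubset Y Q" "Q \<subseteq> Y" "Lnonempty Y F"
  shows "Lnonempty Q (restrict F Q)"
proof -
  have "(SUP y\<in>Y. F y) \<le> (SUP y\<in>Q. restrict F Q y)"
  proof (rule SUP_least)
    fix y assume "y \<in> Y"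
    then show "F y \<le> (SUP y\<in>Q. restrict F Q y)"
      using le_char_bot[OF assms(1)] by (cases "y \<in> Q") (auto intro: SUP_upper2)
  qed
  then show ?thesis using assms(3) by (simp add: Lnonempty_def one_le_iff)
qed

lemma Lfinite_restrict:
  assumes F: "F \<le> char_Lsubset Y Q" "Q \<subseteq> Y" "Lfinite Y F"
  shows "Lfinite Q (restrict F Q)"
  unfolding Lfinite_def
proof (intro conjI allI impI)
  show "restrict F Q \<in> Lsubsets Q" by (simp add: Lsubsets_def)
  fix D :: "('a \<Rightarrow> 'b) set"
  assume D: "D \<subseteq> Lsubsets Q \<and> directed D"
  \<comment> \<open>Finiteness of \<open>F\<close> speaks of families on \<open>Y\<close>, so a
    family on \<open>Q\<close> is extended to \<open>Y\<close>. The values off \<open>Q\<close> do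
    not affect \<open>sub Y F\<close>, as \<open>F\<close> is bottom there.\<close>
  define ext where "ext A = (\<lambda>y\<in>Y. if y \<in> Q then A y else bot)" for A :: "'a \<Rightarrow> 'b"
  have sub_ext: "sub Q (restrict F Q) A = sub Q (restrict F Q) (ext A)" for A
    using F(2) by (intro sub_cong) (auto simp: ext_def)
  have "directed (ext ` D)"
    using D by (intro directed_image) (auto simp: ext_def le_fun_def)
  moreover have "ext ` D \<subseteq> Lsubsets Y" by (auto simp: ext_def Lsubsets_def)
  ultimately have "sub Y F (Ljoin Y (ext ` D)) = (SUP A\<in>ext ` D. sub Y F A)"
    using F(3) unfolding Lfinite_def by blast
  also have "\<dots> = (SUP A\<in>D. sub Q (restrict F Q) A)"
    by (simp add: image_image sub_ext[symmetric] sub_restrict[OF F(1,2), symmetric])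
  also have "sub Y F (Ljoin Y (ext ` D)) = sub Q (restrict F Q) (Ljoin Q D)"
    unfolding sub_restrict[OF F(1,2), symmetric] using F(2)
    by (intro sub_cong) (auto simp: Ljoin_def ext_def image_image)
  finally show "sub Q (restrict F Q) (Ljoin Q D) = (SUP A\<in>D. sub Q (restrict F Q) A)" .
qed

lemma sub_point:
  assumes "x \<in> X"
  shows "sub X (point_Lsubset X x) A = A x"
proof -
  have "a \<le> sub X (point_Lsubset X x) A \<longleftrightarrow> a \<le> A x" for a
    using assms by (auto simp: le_sub_iff char_Lsubset_def mult_bot)
  then show ?thesis by (meson antisym order_refl)
qed

lemma Lnonempty_point:
  assumes "x \<in> X"
  shows "Lnonempty X (point_Lsubset X x)"
proof -
  have "point_Lsubset X x x \<le> (SUP y\<in>X. point_Lsubset X x y)" using assms by (rule SUP_upper)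
  then show ?thesis using assms one_le_iff by (simp add: Lnonempty_def char_Lsubset_def)
qed

text \<open>By \<open>sub_point\<close>, testing against a point is evaluation at it, and joins are
  computed pointwise.\<close>

lemma Lfinite_point:
  assumes "x \<in> X"
  shows "Lfinite X (point_Lsubset X x)"
  using assms by (simp add: Lfinite_def char_in_Lsubsets sub_point Ljoin_def)

text \<open>This form of "supremum of an image" mentions neither the image nor down-sets. It lets
  suprema in \<open>M\<close> be compared with values of \<open>sub\<close> on convex sets.\<close>

lemma is_Lsup_Limage_iff:
  assumes "f \<in> X \<rightarrow> M"
  shows "is_Lsup M e (Limage X M f F) m \<longleftrightarrow> m \<in> M \<and> (\<forall>z\<in>M. e m z = sub X F (\<lambda>x. e (f x) z))"
proof -
  have "sub M (Limage X M f F) (down M e z) = sub X F (\<lambda>x. e (f x) z)" for z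
    unfolding sub_Limage[OF assms] using assms by (intro sub_cong) (auto simp: down_def)
  then show ?thesis by (simp add: is_Lsup_def)
qed

lemma is_Lsup_iff:
  "is_Lsup M e F m \<longleftrightarrow> m \<in> M \<and> (\<forall>z\<in>M. e m z = sub M F (\<lambda>x. e x z))"
proof -
  have "sub M F (down M e z) = sub M F (\<lambda>x. e x z)" for z
    by (intro sub_cong) (auto simp: down_def)
  then show ?thesis by (simp add: is_Lsup_def)
qed

text \<open>Testing at \<open>z = m\<close> and at \<open>z = m'\<close> gives both inequalities
  with value 1.\<close>

lemma Lordered_set_eqI:
  assumes "Lordered_set M e" "m \<in> M" "m' \<in> M" "\<forall>z\<in>M. e m z = e m' z"
  shows "m = m'"
proof -
  have "e m m' = 1" "e m' m = 1" using assms(1-3) assms(4)[rule_format, of m] assms(4)[rule_format, of m']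
    by (simp_all add: Lordered_set_def)
  then show ?thesis using assms(1-3) by (simp add: Lordered_set_def)
qed


section \<open>Hulls and compact convex sets\<close>

lemma convex_Lsubsets: "Lconvex_structure X \<C> \<Longrightarrow> A \<in> \<C> \<Longrightarrow> A \<in> Lsubsets X"
  by (auto simp: Lconvex_structure_def)

lemma hull_convex:
  assumes "Lconvex_structure X \<C>"
  shows "hull X \<C> A \<in> \<C>"
  using assms by (auto simp: Lconvex_structure_def hull_def)

lemma hull_upper:
  assumes "A \<in> Lsubsets X" "x \<in> X"
  shows "A x \<le> hull X \<C> A x"
  using assms(2) by (auto simp: hull_def Lmeet_def le_fun_def intro: INF_greatest)

lemma hull_least:
  assumes "B \<in> \<C>" "A \<le> B" "x \<in> X"
  shows "hull X \<C> A x \<le> B x"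
  using assms by (auto simp: hull_def Lmeet_def le_fun_def intro!: INF_lower2[of B])

text \<open>An inequality weighted by \<open>a\<close> against \<open>A\<close> is a plain
  inequality against \<open>Lcotensor X a A\<close>. This set is again convex, so passing from
  \<open>F\<close> to its hull changes nothing.\<close>

lemma sub_hull:
  assumes C: "Lconvex_structure X \<C>" and F: "F \<in> Lsubsets X" and A: "A \<in> \<C>"
  shows "sub X (hull X \<C> F) A = sub X F A"
proof (rule sub_eqI)
  fix a
  have cot: "Lcotensor X a A \<in> \<C>" using C A by (simp add: Lconvex_structure_def)
  have eq: "a * G \<le> A x \<longleftrightarrow> G \<le> Lcotensor X a A x" if "x \<in> X" for x G
    using that by (simp add: Lcotensor_def residuum_adjoint[symmetric] mult.commute)
  show "(\<forall>x\<in>X. a * hull X \<C> F x \<le> A x) \<longleftrightarrow> (\<forall>x\<in>X. a * F x \<le> A x)"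
  proof
    assume "\<forall>x\<in>X. a * hull X \<C> F x \<le> A x"
    then show "\<forall>x\<in>X. a * F x \<le> A x"
      using hull_upper[OF F] by (meson eq order_trans)
  next
    assume "\<forall>x\<in>X. a * F x \<le> A x"
    then have "F \<le> Lcotensor X a A"
      using Lsubset_le_iff[OF F convex_Lsubsets[OF C cot]] eq by simp
    then show "\<forall>x\<in>X. a * hull X \<C> F x \<le> A x" using hull_least[OF cot] eq by blast
  qed
qed

text \<open>The convex sets above \<open>F\<close> are those \<open>A\<close> with
  \<open>sub X F A = 1\<close>, so the values of \<open>sub\<close> determine the hull.\<close>

lemma hull_eq_iff:
  assumes C: "Lconvex_structure X \<C>" and FG: "F \<in> Lsubsets X" "G \<in> Lsubsets X"
  shows "hull X \<C> F = hull X \<C> G \<longleftrightarrow> (\<forall>A\<in>\<C>. sub X F A = sub X G A)"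
proof
  assume "hull X \<C> F = hull X \<C> G"
  then show "\<forall>A\<in>\<C>. sub X F A = sub X G A" using sub_hull[OF C] FG by metis
next
  assume "\<forall>A\<in>\<C>. sub X F A = sub X G A"
  then have "{B \<in> \<C>. F \<le> B} = {B \<in> \<C>. G \<le> B}"
    using FG convex_Lsubsets[OF C] sub_eq_one_iff_le by (metis (lifting))
  then show "hull X \<C> F = hull X \<C> G" by (simp add: hull_def)
qed

section \<open>Compact convex sets and the map \<open>phi\<close>\<close>

lemma cp_convex: "K \<in> cp X \<C> \<Longrightarrow> K \<in> \<C>"
  by (simp add: cp_def)

text \<open>Directed joins of convex sets are convex, so \<open>sub_hull\<close> replaces the hull
  by \<open>F\<close> on both sides of the compactness equation, which is then finiteness of
  \<open>F\<close>.\<close>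

lemma hull_in_cp:
  assumes C: "Lconvex_structure X \<C>" and F: "Lfinite X F" "Lnonempty X F"
  shows "hull X \<C> F \<in> cp X \<C>"
  unfolding cp_def
proof (intro CollectI conjI allI impI)
  have FL: "F \<in> Lsubsets X" using F by (simp add: Lfinite_def)
  show "hull X \<C> F \<in> \<C>" by (rule hull_convex[OF C])
  have "(SUP x\<in>X. F x) \<le> (SUP x\<in>X. hull X \<C> F x)"
    using hull_upper[OF FL] by (intro SUP_mono) blast
  then show "Lnonempty X (hull X \<C> F)" using F by (simp add: Lnonempty_def one_le_iff)
  fix D assume D: "D \<subseteq> \<C> \<and> directed D"
  then have "Ljoin X D \<in> \<C>" "D \<subseteq> Lsubsets X"
    using C by (auto simp: Lconvex_structure_def)
  then show "sub X (hull X \<C> F) (Ljoin X D) = (SUP A\<in>D. sub X (hull X \<C> F) A)"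
    using sub_hull[OF C FL] D F(1) unfolding Lfinite_def by (simp add: subset_iff)
qed

lemma point_hull_in_cp:
  assumes "Lconvex_structure X \<C>" "x \<in> X"
  shows "hull X \<C> (point_Lsubset X x) \<in> cp X \<C>"
  using assms by (simp add: hull_in_cp Lfinite_point Lnonempty_point)

lemma sub_point_hull:
  assumes "Lconvex_structure X \<C>" "x \<in> X" "A \<in> \<C>"
  shows "sub X (hull X \<C> (point_Lsubset X x)) A = A x"
  using assms by (simp add: sub_hull char_in_Lsubsets sub_point)

lemma phi_Ljoin:
  assumes "D \<subseteq> \<C>" "directed D"
  shows "phi X \<C> (Ljoin X D) = Ljoin (cp X \<C>) (phi X \<C> ` D)"
proof
  fix K
  have "sub X K (Ljoin X D) = (SUP A\<in>D. sub X K A)" if "K \<in> cp X \<C>"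
    using that assms by (simp add: cp_def)
  then show "phi X \<C> (Ljoin X D) K = Ljoin (cp X \<C>) (phi X \<C> ` D) K"
    by (auto simp: phi_def Ljoin_def image_image)
qed

lemma phi_mono:
  assumes "A \<le> B"
  shows "phi X \<C> A \<le> phi X \<C> B"
proof -
  have "sub X K A \<le> sub X K B" for K
    using order_trans[OF sub_mult_le[of _ X K A] le_funD[OF assms]] by (simp add: le_sub_iff)
  then show ?thesis by (simp add: phi_def le_fun_def)
qed

text \<open>Hulls of points are compact, and evaluating \<open>phi X \<C> A\<close> at the hull of
  \<open>x\<close> recovers \<open>A x\<close>.\<close>

lemma phi_le_imp_le:
  assumes C: "Lconvex_structure X \<C>" and AB: "A \<in> \<C>" "B \<in> \<C>" "phi X \<C> A \<le> phi X \<C> B"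
  shows "A \<le> B"
proof -
  have "A x \<le> B x" if "x \<in> X" for x
    using le_funD[OF AB(3), of "hull X \<C> (point_Lsubset X x)"] that
    by (simp add: phi_def point_hull_in_cp[OF C] sub_point_hull[OF C] AB)
  then show ?thesis using Lsubset_le_iff convex_Lsubsets[OF C] AB by blast
qed

text \<open>\<open>phi\<close> carries constants, directed joins, meets and cotensors of convex sets
  to the same operations on \<open>cp X \<C>\<close>, so its range is closed under them.\<close>

lemma Cp_Lconvex_structure:
  fixes \<C> :: "('a \<Rightarrow> 'l::complete_residuated_lattice) set"
  assumes C: "Lconvex_structure X \<C>"
  shows "Lconvex_structure (cp X \<C>) (Cp_structure X \<C>)"
  unfolding Lconvex_structure_def
proof (intro conjI allI impI ballI)
  let ?Y = "cp X \<C>"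
  show "Cp_structure X \<C> \<subseteq> Lsubsets ?Y" by (auto simp: Cp_structure_def phi_def Lsubsets_def)
  \<comment> \<open>The values of \<open>K\<close> have join 1, so multiplying by that join and
    distributing bounds the left side by bottom.\<close>
  have "sub X K (Lconst X bot) = bot" if "K \<in> ?Y" for K
  proof -
    let ?s = "sub X K (Lconst X bot)"
    have "?s = ?s * (SUP x\<in>X. K x)" using that by (simp add: cp_def Lnonempty_def)
    also have "\<dots> = (SUP x\<in>X. ?s * K x)" by (rule mult_SUP)
    also have "\<dots> \<le> bot"
      using sub_mult_le[of _ X K "Lconst X bot"] by (intro SUP_least) (simp add: Lconst_def)
    finally show ?thesis by (simp add: bot_unique)
  qed
  then have "Lconst ?Y bot = phi X \<C> (Lconst X bot)" by (auto simp: Lconst_def[of ?Y] phi_def)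
  then show "Lconst ?Y bot \<in> Cp_structure X \<C>"
    using C by (auto simp: Cp_structure_def Lconvex_structure_def)
  have "sub X K (Lconst X 1) = 1" for K :: "'a \<Rightarrow> 'l"
    by (simp add: sub_eq_one_iff Lconst_def le_one)
  then have "Lconst ?Y 1 = phi X \<C> (Lconst X 1)" by (simp add: Lconst_def[of ?Y] phi_def)
  then show "Lconst ?Y 1 \<in> Cp_structure X \<C>"
    using C by (auto simp: Cp_structure_def Lconvex_structure_def)
next
  let ?Y = "cp X \<C>"
  fix D assume D: "D \<subseteq> Cp_structure X \<C> \<and> directed D"
  define D' where "D' = {A \<in> \<C>. phi X \<C> A \<in> D}"
  have img: "phi X \<C> ` D' = D" using D by (auto simp: D'_def Cp_structure_def)
  have D'C: "D' \<subseteq> \<C>" by (auto simp: D'_def)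
  \<comment> \<open>Upper bounds in \<open>D\<close> lift to \<open>D'\<close> because
    \<open>phi\<close> reflects the order.\<close>
  have "directed D'" unfolding directed_def
  proof (intro conjI ballI)
    show "D' \<noteq> {}" using img D by (auto simp: directed_def)
    fix A B assume AB: "A \<in> D'" "B \<in> D'"
    then obtain E where "E \<in> D'" "phi X \<C> A \<le> phi X \<C> E" "phi X \<C> B \<le> phi X \<C> E"
      using D img unfolding directed_def by (metis (no_types, lifting) imageE imageI)
    then show "\<exists>E\<in>D'. A \<le> E \<and> B \<le> E"
      using AB D'C phi_le_imp_le[OF C] by blast
  qed
  then have "Ljoin ?Y D = phi X \<C> (Ljoin X D')" "Ljoin X D' \<in> \<C>"
    using phi_Ljoin[OF D'C] img C D'C by (auto simp: Lconvex_structure_def)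
  then show "Ljoin ?Y D \<in> Cp_structure X \<C>" by (auto simp: Cp_structure_def)
next
  let ?Y = "cp X \<C>"
  fix S assume S: "S \<subseteq> Cp_structure X \<C>"
  define S' where "S' = {A \<in> \<C>. phi X \<C> A \<in> S}"
  have img: "phi X \<C> ` S' = S" using S by (auto simp: S'_def Cp_structure_def)
  have "a \<le> sub X K (Lmeet X S') \<longleftrightarrow> a \<le> (INF A\<in>S'. sub X K A)" for a K
    by (auto simp: le_sub_iff Lmeet_def le_INF_iff)
  then have "sub X K (Lmeet X S') = (INF A\<in>S'. sub X K A)" for K
    by (meson antisym order_refl)
  then have "Lmeet ?Y (phi X \<C> ` S') = phi X \<C> (Lmeet X S')"
    by (auto simp: Lmeet_def[of ?Y] phi_def image_image)
  moreover have "Lmeet X S' \<in> \<C>" using C by (auto simp: S'_def Lconvex_structure_def)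
  ultimately show "Lmeet ?Y S \<in> Cp_structure X \<C>" using img by (auto simp: Cp_structure_def)
next
  let ?Y = "cp X \<C>"
  fix a and B assume "B \<in> Cp_structure X \<C>"
  then obtain A where A: "A \<in> \<C>" "B = phi X \<C> A" by (auto simp: Cp_structure_def)
  have "b \<le> sub X K (Lcotensor X a A) \<longleftrightarrow> b \<le> a \<leadsto> sub X K A" for b K
    by (simp add: le_sub_iff Lcotensor_def residuum_adjoint[symmetric] ac_simps)
  then have "sub X K (Lcotensor X a A) = a \<leadsto> sub X K A" for K
    by (meson antisym order_refl)
  then have "Lcotensor ?Y a B = phi X \<C> (Lcotensor X a A)"
    by (auto simp: Lcotensor_def[of ?Y] phi_def A)
  moreover have "Lcotensor X a A \<in> \<C>" using C A by (simp add: Lconvex_structure_def)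
  ultimately show "Lcotensor ?Y a B \<in> Cp_structure X \<C>" by (auto simp: Cp_structure_def)
qed

text \<open>The right-hand side says that \<open>K\<close> is the supremum of \<open>F\<close> in \<open>\<C>\<close> ordered by inclusion.\<close>

lemma Cp_hull_eq_iff:
  assumes C: "Lconvex_structure X \<C>" and F: "F \<in> Lsubsets (cp X \<C>)" and K: "K \<in> cp X \<C>"
  shows "hull (cp X \<C>) (Cp_structure X \<C>) F =
      hull (cp X \<C>) (Cp_structure X \<C>) (point_Lsubset (cp X \<C>) K) \<longleftrightarrow>
    (\<forall>A\<in>\<C>. sub X K A = sub (cp X \<C>) F (\<lambda>K. sub X K A))"
proof -
  have "sub (cp X \<C>) F (phi X \<C> A) = sub (cp X \<C>) F (\<lambda>K. sub X K A)" for A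
    by (intro sub_cong) (auto simp: phi_def)
  then show ?thesis
    unfolding hull_eq_iff[OF Cp_Lconvex_structure[OF C] F char_in_Lsubsets]
    using K by (auto simp: Cp_structure_def sub_point phi_def[of X \<C>])
qed

text \<open>The supremum is the hull of the weighted union of the sets \<open>K\<close> with weights
  \<open>F K\<close>. Its \<open>sub\<close> into \<open>A\<close> is that of \<open>F\<close> into
  \<open>phi X \<C> A\<close>; as \<open>phi\<close> preserves directed joins, compactness comes
  from finiteness of \<open>F\<close>.\<close>

lemma cp_supremum_exists:
  assumes C: "Lconvex_structure X \<C>"
    and F: "Lfinite (cp X \<C>) F" "Lnonempty (cp X \<C>) F"
  shows "\<exists>K\<in>cp X \<C>. \<forall>A\<in>\<C>. sub X K A = sub (cp X \<C>) F (\<lambda>K. sub X K A)"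
proof -
  let ?Y = "cp X \<C>"
  define U where "U = (\<lambda>x\<in>X. SUP K\<in>?Y. F K * K x)"
  have U: "U \<in> Lsubsets X" by (auto simp: U_def Lsubsets_def)
  let ?K = "hull X \<C> U"
  have "sub X U A = sub ?Y F (\<lambda>K. sub X K A)" for A
  proof (rule sub_eqI)
    fix a
    show "(\<forall>x\<in>X. a * U x \<le> A x) \<longleftrightarrow> (\<forall>K\<in>?Y. a * F K \<le> sub X K A)"
      by (auto simp: U_def mult_SUP SUP_le_iff le_sub_iff ac_simps)
  qed
  then have sup: "sub X ?K A = sub ?Y F (\<lambda>K. sub X K A)" if "A \<in> \<C>" for A
    using sub_hull[OF C U that] by simp
  have "?K \<in> ?Y" unfolding cp_def
  proof (intro CollectI conjI allI impI)
    show "?K \<in> \<C>" by (rule hull_convex[OF C])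
    \<comment> \<open>Each \<open>K\<close> has join 1, so no weight \<open>F K\<close> is lost in
      the join of the weighted union.\<close>
    have "(SUP K\<in>?Y. F K) \<le> (SUP x\<in>X. ?K x)"
    proof (rule SUP_least)
      fix K assume K: "K \<in> ?Y"
      then have "F K = F K * (SUP x\<in>X. K x)" by (simp add: cp_def Lnonempty_def)
      also have "\<dots> = (SUP x\<in>X. F K * K x)" by (rule mult_SUP)
      also have "\<dots> \<le> (SUP x\<in>X. ?K x)"
      proof (rule SUP_mono)
        fix x assume x: "x \<in> X"
        have "F K * K x \<le> U x" using K x by (auto simp: U_def intro: SUP_upper)
        also have "\<dots> \<le> ?K x" using hull_upper[OF U x] .
        finally show "\<exists>y\<in>X. F K * K x \<le> ?K y" using x by blast
      qed
      finally show "F K \<le> (SUP x\<in>X. ?K x)" .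
    qed
    then show "Lnonempty X ?K" using F(2) by (simp add: Lnonempty_def one_le_iff)
    fix D assume D: "D \<subseteq> \<C> \<and> directed D"
    have phi: "sub ?Y F (\<lambda>K. sub X K A) = sub ?Y F (phi X \<C> A)" for A
      by (intro sub_cong) (auto simp: phi_def)
    have "directed (phi X \<C> ` D)" using D by (intro directed_image phi_mono) auto
    moreover have "phi X \<C> ` D \<subseteq> Lsubsets ?Y" by (auto simp: phi_def Lsubsets_def)
    ultimately have "sub ?Y F (Ljoin ?Y (phi X \<C> ` D)) = (SUP A\<in>phi X \<C> ` D. sub ?Y F A)"
      using F(1) unfolding Lfinite_def by blast
    also have "\<dots> = (SUP A\<in>D. sub X ?K A)"
      unfolding image_image using D by (intro SUP_cong refl) (auto simp: sup phi)
    also have "sub ?Y F (Ljoin ?Y (phi X \<C> ` D)) = sub X ?K (Ljoin X D)"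
      using D C by (subst sup) (auto simp: phi phi_Ljoin Lconvex_structure_def)
    finally show "sub X ?K (Ljoin X D) = (SUP A\<in>D. sub X ?K A)" .
  qed
  then show ?thesis using sup by blast
qed


section \<open>The F-completion\<close>

lemma F_closed_carrier: "F_closed Y \<C> Y"
  by (simp add: F_closed_def)

text \<open>An \<open>F\<close> below the characteristic L-subset of the intersection is below that
  of each F-closed set containing \<open>Z\<close>, so each of them contains the required
  \<open>y\<close>.\<close>

lemma F_closed_F_closure:
  assumes "Z \<subseteq> Y"
  shows "F_closed Y \<C> (F_closure Y \<C> Z)"
proof -
  have le: "(char_Lsubset Y (F_closure Y \<C> Z) :: _ \<Rightarrow> 'b) \<le> char_Lsubset Y A"
    if "F_closed Y \<C> A" "Z \<subseteq> A" for A
    using that by (auto simp: F_closure_def char_Lsubset_def le_fun_def)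
  show ?thesis unfolding F_closed_def
  proof (intro conjI allI ballI impI)
    show "F_closure Y \<C> Z \<subseteq> Y" using F_closed_carrier assms unfolding F_closure_def by blast
    fix F y
    assume y: "y \<in> Y" and F: "Lnonempty Y F \<and> Lfinite Y F \<and>
      F \<le> char_Lsubset Y (F_closure Y \<C> Z) \<and> hull Y \<C> F = hull Y \<C> (point_Lsubset Y y)"
    have "y \<in> A" if "F_closed Y \<C> A" "Z \<subseteq> A" for A
    proof -
      have "F \<le> char_Lsubset Y A" using F order_trans[OF _ le[OF that]] by blast
      then show ?thesis using that(1) F y unfolding F_closed_def by blast
    qed
    then show "y \<in> F_closure Y \<C> Z" by (simp add: F_closure_def)
  qed
qed

context
  fixes X :: "'a set" and \<C> :: "('a \<Rightarrow> 'l::complete_residuated_lattice) set"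
  assumes C: "Lconvex_structure X \<C>"
begin

abbreviation (input) "point_hull \<equiv> (\<lambda>x. hull X \<C> (point_Lsubset X x))"

lemma F_completion_subset: "F_completion X \<C> \<subseteq> cp X \<C>"
  and point_hull_in_F_completion: "x \<in> X \<Longrightarrow> point_hull x \<in> F_completion X \<C>"
  and F_closed_F_completion: "F_closed (cp X \<C>) (Cp_structure X \<C>) (F_completion X \<C>)"
proof -
  have "point_hull ` X \<subseteq> cp X \<C>" using point_hull_in_cp[OF C] by blast
  then show *: "F_closed (cp X \<C>) (Cp_structure X \<C>) (F_completion X \<C>)"
    unfolding F_completion_def by (rule F_closed_F_closure)
  show "F_completion X \<C> \<subseteq> cp X \<C>" using * by (simp add: F_closed_def)
  show "x \<in> X \<Longrightarrow> point_hull x \<in> F_completion X \<C>"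
    unfolding F_completion_def F_closure_def by blast
qed

lemma F_completion_convex: "K \<in> F_completion X \<C> \<Longrightarrow> K \<in> \<C>"
  using F_completion_subset cp_convex by blast

lemma Lordered_set_F_completion: "Lordered_set (F_completion X \<C>) (sub X)"
  using Lordered_set_sub F_completion_convex convex_Lsubsets[OF C] by (metis subsetI)

text \<open>The supremum is formed among all compact convex sets. Since \<open>F\<close>, pushed
  along the inclusion, is supported on the completion, F-closedness puts that supremum into the
  completion.\<close>

lemma F_completion_supremum_exists:
  assumes F: "Lfinite (F_completion X \<C>) F" "Lnonempty (F_completion X \<C>) F"
  shows "\<exists>K\<in>F_completion X \<C>. \<forall>A\<in>\<C>. sub X K A = sub (F_completion X \<C>) F (\<lambda>K. sub X K A)"
proof -
  let ?Q = "F_completion X \<C>" and ?Y = "cp X \<C>"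
  let ?G = "Limage ?Q ?Y (\<lambda>K. K) F"
  have inc: "(\<lambda>K. K) \<in> ?Q \<rightarrow> ?Y" using F_completion_subset by auto
  note G = Lfinite_Limage[OF inc F(1)] Lnonempty_Limage[OF inc F(2)]
    Limage_inclusion_le_char[OF F_completion_subset, of F]
  obtain K where K: "K \<in> ?Y" "\<forall>A\<in>\<C>. sub X K A = sub ?Y ?G (\<lambda>K. sub X K A)"
    using cp_supremum_exists[OF C G(1,2)] by blast
  then have "K \<in> ?Q"
    using F_closed_F_completion G Cp_hull_eq_iff[OF C Limage_in_Lsubsets K(1)]
    unfolding F_closed_def by blast
  then show ?thesis using K(2) unfolding sub_Limage[OF inc] by blast
qed

text \<open>A supremum in the completion is tested only against its members, the right-hand side
  against every convex set. The stronger kind exists, and suprema are unique, so the two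
  agree.\<close>

lemma F_completion_Lsup_iff:
  assumes F: "Lfinite (F_completion X \<C>) F" "Lnonempty (F_completion X \<C>) F"
  shows "is_Lsup (F_completion X \<C>) (sub X) F K \<longleftrightarrow>
    K \<in> F_completion X \<C> \<and> (\<forall>A\<in>\<C>. sub X K A = sub (F_completion X \<C>) F (\<lambda>K. sub X K A))"
    (is "_ \<longleftrightarrow> ?sup K")
proof
  have imp: "?sup K \<Longrightarrow> is_Lsup (F_completion X \<C>) (sub X) F K" for K
    unfolding is_Lsup_iff using F_completion_convex by blast
  then show "?sup K \<Longrightarrow> is_Lsup (F_completion X \<C>) (sub X) F K" .
  obtain K' where K': "?sup K'" using F_completion_supremum_exists[OF F] by blast
  assume "is_Lsup (F_completion X \<C>) (sub X) F K"
  then have "K = K'" using is_Lsup_unique[OF Lordered_set_F_completion] imp[OF K'] by blast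
  then show "?sup K" using K' by simp
qed

lemma Ljoin_semilattice_F_completion: "Ljoin_semilattice (F_completion X \<C>) (sub X)"
  unfolding Ljoin_semilattice_def
  using Lordered_set_F_completion F_completion_supremum_exists F_completion_Lsup_iff by blast

text \<open>The members satisfying \<open>R\<close> form an F-closed set that contains the point
  hulls. In the case \<open>sup\<close>, \<open>F\<close> lives on a set \<open>S\<close> all of
  whose members satisfy \<open>R\<close>, so that the hypothesis covers the whole carrier of
  \<open>F\<close>.\<close>

lemma F_completion_induct [consumes 1, case_names point sup]:
  assumes K: "K \<in> F_completion X \<C>"
    and point: "\<And>x. x \<in> X \<Longrightarrow> R (point_hull x)"
    and sup: "\<And>F S K. \<lbrakk>S \<subseteq> F_completion X \<C>; \<And>K. K \<in> S \<Longrightarrow> R K; Lfinite S F; Lnonempty S F;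
      K \<in> F_completion X \<C>; \<And>A. A \<in> \<C> \<Longrightarrow> sub X K A = sub S F (\<lambda>K. sub X K A)\<rbrakk> \<Longrightarrow> R K"
  shows "R K"
proof -
  let ?Y = "cp X \<C>"
  let ?S = "{K \<in> F_completion X \<C>. R K}"
  have SY: "?S \<subseteq> ?Y" using F_completion_subset by blast
  have "F_closed ?Y (Cp_structure X \<C>) ?S" unfolding F_closed_def
  proof (intro conjI allI ballI impI)
    show "?S \<subseteq> ?Y" by (rule SY)
    fix F K
    assume KY: "K \<in> ?Y" and F: "Lnonempty ?Y F \<and> Lfinite ?Y F \<and> F \<le> char_Lsubset ?Y ?S \<and>
      hull ?Y (Cp_structure X \<C>) F = hull ?Y (Cp_structure X \<C>) (point_Lsubset ?Y K)"
    then have FS: "F \<le> char_Lsubset ?Y ?S" and FL: "F \<in> Lsubsets ?Y"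
      by (auto simp: Lfinite_def)
    have "(char_Lsubset ?Y ?S :: _ \<Rightarrow> 'l) \<le> char_Lsubset ?Y (F_completion X \<C>)"
      by (auto simp: char_Lsubset_def le_fun_def)
    then have "F \<le> char_Lsubset ?Y (F_completion X \<C>)" using FS by (rule order_trans[rotated])
    then have KQ: "K \<in> F_completion X \<C>"
      using F_closed_F_completion F KY unfolding F_closed_def by blast
    \<comment> \<open>The hull equation says that \<open>K\<close> is the supremum of
      \<open>F\<close>; restricting \<open>F\<close> to its support keeps this.\<close>
    have "sub X K A = sub ?S (restrict F ?S) (\<lambda>K. sub X K A)" if "A \<in> \<C>" for A
      using F Cp_hull_eq_iff[OF C FL KY] that sub_restrict[OF FS SY] by metis
    then have "R K"
      using sup[of ?S "restrict F ?S" K] KQ F Lfinite_restrict[OF FS SY] Lnonempty_restrict[OF FS SY]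
      by blast
    then show "K \<in> ?S" using KQ by blast
  qed
  moreover have "point_hull ` X \<subseteq> ?S" using point point_hull_in_F_completion by blast
  ultimately have "F_completion X \<C> \<subseteq> ?S" unfolding F_completion_def F_closure_def by blast
  then show ?thesis using K by blast
qed

end


section \<open>The universal property\<close>

text \<open>One inequality is Scott convexity. For the other, \<open>F x\<close> is at most
  \<open>e x s\<close>, and \<open>B\<close> is a lower set.\<close>

lemma Scott_Lconvex_Lsup:
  assumes P: "Lordered_set P e" and B: "B \<in> Scott_Lconvex P e"
    and F: "Lnonempty P F" "Lfinite P F" "is_Lsup P e F s"
  shows "sub P F B = B s"
proof (rule antisym)
  show "sub P F B \<le> B s" using B F by (auto simp: Scott_Lconvex_def)
  have s: "s \<in> P" "sub P F (\<lambda>x. e x s) = 1"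
    using P F(3) by (auto simp: is_Lsup_iff Lordered_set_def)
  have "B s * F x \<le> B x" if "x \<in> P" for x
  proof -
    have "B s * F x \<le> B s * e x s" using s that by (auto simp: sub_eq_one_iff intro: mult_mono_right)
    also have "\<dots> \<le> B x" using B s that by (auto simp: Scott_Lconvex_def lower_Lset_def)
    finally show ?thesis .
  qed
  then show "B s \<le> sub P F B" by (simp add: le_sub_iff)
qed

text \<open>It is a lower set by monotonicity of \<open>f\<close> and transitivity. For Scott
  convexity, \<open>f s\<close> is the supremum of the image of \<open>F\<close>, so the required
  inequality is even an equality.\<close>

lemma Scott_Lconvex_principal_vimage:
  assumes M: "Lordered_set M eM" and f: "Scott_convexity_preserving P e M eM f" and z: "z \<in> M"
  shows "(\<lambda>x\<in>P. eM (f x) z) \<in> Scott_Lconvex P e"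
proof -
  have fM: "f \<in> P \<rightarrow> M" and mono: "\<And>x y. x \<in> P \<Longrightarrow> y \<in> P \<Longrightarrow> e x y \<le> eM (f x) (f y)"
    using f by (auto simp: Scott_convexity_preserving_def Lorder_preserving_def)
  show ?thesis unfolding Scott_Lconvex_def lower_Lset_def
  proof (intro CollectI conjI ballI allI impI)
    show "(\<lambda>x\<in>P. eM (f x) z) \<in> Lsubsets P" by (simp add: Lsubsets_def)
  next
    fix x y assume xy: "x \<in> P" "y \<in> P"
    have "eM (f x) z * e y x \<le> eM (f x) z * eM (f y) (f x)"
      using mono xy by (intro mult_mono_right) blast
    also have "\<dots> = eM (f y) (f x) * eM (f x) z" by (rule mult.commute)
    also have "\<dots> \<le> eM (f y) z"
      using M xy z funcset_mem[OF fM] unfolding Lordered_set_def by blast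
    finally show "(\<lambda>x\<in>P. eM (f x) z) x * e y x \<le> (\<lambda>x\<in>P. eM (f x) z) y" using xy by simp
  next
    fix F s assume F: "Lnonempty P F \<and> Lfinite P F \<and> is_Lsup P e F s"
    then have "is_Lsup M eM (Limage P M f F) (f s)"
      using f by (auto simp: Scott_convexity_preserving_def)
    then have "eM (f s) z = sub P F (\<lambda>x. eM (f x) z)"
      using is_Lsup_Limage_iff[OF fM] z by blast
    also have "\<dots> = sub P F (\<lambda>x\<in>P. eM (f x) z)" by (intro sub_cong) auto
    finally show "sub P F (\<lambda>x\<in>P. eM (f x) z) \<le> (\<lambda>x\<in>P. eM (f x) z) s"
      using F by (simp add: is_Lsup_def)
  qed
qed

text \<open>\<open>xi P e x\<close> represents evaluation at \<open>x\<close> on Scott convex sets.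
  Read this way, preservation of suprema is \<open>Scott_Lconvex_Lsup\<close>.\<close>

lemma Scott_convexity_preserving_xi:
  fixes P :: "'a set" and e :: "'a \<Rightarrow> 'a \<Rightarrow> 'l::complete_residuated_lattice"
  assumes P: "Lordered_set P e"
  shows "Scott_convexity_preserving P e (PF P e) (sub P) (xi P e)"
proof -
  note C = Scott_Lconvex_is_structure[of P e]
  have xi: "xi P e \<in> P \<rightarrow> PF P e"
    using point_hull_in_F_completion[OF C] by (auto simp: xi_def PF_def)
  have sub_xi: "sub P (xi P e x) B = B x" if "x \<in> P" "B \<in> Scott_Lconvex P e" for x B
    using sub_point_hull[OF C that] by (simp add: xi_def)
  have convex: "K \<in> Scott_Lconvex P e" if "K \<in> PF P e" for K
    using F_completion_convex[OF C] that by (simp add: PF_def)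
  have mono: "e x y \<le> sub P (xi P e x) (xi P e y)" if xy: "x \<in> P" "y \<in> P" for x y
  proof -
    have y: "xi P e y \<in> Scott_Lconvex P e" using xi xy convex by blast
    have "sub P (xi P e y) (xi P e y) = 1" by (simp add: sub_eq_one_iff)
    then have "xi P e y y = 1" using sub_xi[OF xy(2) y] by simp
    moreover have "xi P e y y * e x y \<le> xi P e y x"
      using y xy by (auto simp: Scott_Lconvex_def lower_Lset_def)
    ultimately show ?thesis using sub_xi[OF xy(1) y] by simp
  qed
  show ?thesis unfolding Scott_convexity_preserving_def Lorder_preserving_def
  proof (intro conjI ballI allI impI)
    fix F s assume F: "Lnonempty P F \<and> Lfinite P F \<and> is_Lsup P e F s"
    then have s: "s \<in> P" by (simp add: is_Lsup_def)
    have "sub P (xi P e s) B = sub P F (\<lambda>x. sub P (xi P e x) B)" if "B \<in> PF P e" for B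
    proof -
      have "sub P F (\<lambda>x. sub P (xi P e x) B) = sub P F B"
        using sub_xi convex[OF that] by (intro sub_cong) auto
      then show ?thesis using Scott_Lconvex_Lsup[OF P convex[OF that]] F sub_xi[OF s convex[OF that]] by auto
    qed
    then show "is_Lsup (PF P e) (sub P) (Limage P (PF P e) (xi P e) F) (xi P e s)"
      using is_Lsup_Limage_iff[OF xi] xi s by blast
  qed (use xi mono in auto)
qed

lemma Scott_convexity_preserving_PF_unique:
  fixes P :: "'a set" and e :: "'a \<Rightarrow> 'a \<Rightarrow> 'l::complete_residuated_lattice"
  assumes M: "Lordered_set M eM"
    and g: "Scott_convexity_preserving (PF P e) (sub P) M eM g"
    and h: "Scott_convexity_preserving (PF P e) (sub P) M eM h"
    and eq: "\<And>x. x \<in> P \<Longrightarrow> g (xi P e x) = h (xi P e x)"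
    and K: "K \<in> PF P e"
  shows "g K = h K"
proof -
  note C = Scott_Lconvex_is_structure[of P e]
  let ?Q = "PF P e"
  have gM: "g \<in> ?Q \<rightarrow> M" and hM: "h \<in> ?Q \<rightarrow> M"
    using g h by (auto simp: Scott_convexity_preserving_def Lorder_preserving_def)
  show ?thesis using K unfolding PF_def
  proof (induction rule: F_completion_induct[OF C, consumes 1, case_names point sup])
    case (point x)
    then show ?case using eq[of x] by (simp add: xi_def)
  next
    case (sup F S K)
    have SQ: "S \<subseteq> ?Q" and KQ: "K \<in> ?Q" using sup.hyps by (simp_all add: PF_def)
    have inc: "(\<lambda>K. K) \<in> S \<rightarrow> ?Q" using SQ by auto
    let ?G = "Limage S ?Q (\<lambda>K. K) F"
    have "is_Lsup ?Q (sub P) ?G K"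
      unfolding is_Lsup_Limage_iff[OF inc] using sup.hyps KQ F_completion_convex[OF C]
      by (auto simp: PF_def)
    then have G: "is_Lsup M eM (Limage ?Q M g ?G) (g K)" "is_Lsup M eM (Limage ?Q M h ?G) (h K)"
      using g h Lfinite_Limage[OF inc sup.hyps(2)] Lnonempty_Limage[OF inc sup.hyps(3)]
      unfolding Scott_convexity_preserving_def by blast+
    \<comment> \<open>Both maps preserve the supremum \<open>K\<close>, so their values there depend
      only on their values on \<open>S\<close>, where they agree.\<close>
    have "eM (g K) z = eM (h K) z" if "z \<in> M" for z
    proof -
      have "eM (g K) z = sub S F (\<lambda>K. eM (g K) z)"
        using G(1) that by (simp add: is_Lsup_Limage_iff[OF gM] sub_Limage[OF inc])
      also have "\<dots> = sub S F (\<lambda>K. eM (h K) z)" using sup.IH by (intro sub_cong) auto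
      also have "\<dots> = eM (h K) z"
        using G(2) that by (simp add: is_Lsup_Limage_iff[OF hM] sub_Limage[OF inc])
      finally show ?thesis .
    qed
    then show ?case using Lordered_set_eqI[OF M] gM hM KQ by blast
  qed
qed

lemma Scott_convexity_preserving_PF_extension:
  fixes P :: "'a set" and e :: "'a \<Rightarrow> 'a \<Rightarrow> 'l::complete_residuated_lattice"
  assumes M: "Ljoin_semilattice M eM" and f: "Scott_convexity_preserving P e M eM f"
  shows "\<exists>g\<in>extensional (PF P e). Scott_convexity_preserving (PF P e) (sub P) M eM g \<and>
    (\<forall>x\<in>P. g (xi P e x) = f x)"
proof -
  note C = Scott_Lconvex_is_structure[of P e]
  let ?Q = "PF P e"
  have ordM: "Lordered_set M eM" using M by (simp add: Ljoin_semilattice_def)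
  have fM: "f \<in> P \<rightarrow> M" using f by (simp add: Scott_convexity_preserving_def Lorder_preserving_def)
  define I where "I z = (\<lambda>x\<in>P. eM (f x) z)" for z
  have I: "I z \<in> Scott_Lconvex P e" if "z \<in> M" for z
    unfolding I_def by (rule Scott_Lconvex_principal_vimage[OF ordM f that])
  \<comment> \<open>A relation, since existence of \<open>m\<close> is known only after the
    induction; at most one \<open>m\<close> fits, by antisymmetry of \<open>eM\<close>.\<close>
  define ext where "ext K m \<longleftrightarrow> m \<in> M \<and> (\<forall>z\<in>M. eM m z = sub P K (I z))" for K m
  have ext_xi: "ext (xi P e x) (f x)" if "x \<in> P" for x
    using that fM sub_point_hull[OF C that I] by (auto simp: ext_def xi_def I_def)
  have "\<exists>m. ext K m" if "K \<in> ?Q" for K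
    using that unfolding PF_def
  proof (induction rule: F_completion_induct[OF C, consumes 1, case_names point sup])
    case (point x)
    then show ?case using ext_xi unfolding xi_def by blast
  next
    case (sup F S K)
    \<comment> \<open>The elements already found for the members of \<open>S\<close> form a map into
      \<open>M\<close>; the supremum in \<open>M\<close> of the image of \<open>F\<close> under it
      is the element for \<open>K\<close>.\<close>
    then obtain h where h: "\<And>K. K \<in> S \<Longrightarrow> ext K (h K)" by metis
    then have hM: "h \<in> S \<rightarrow> M" by (auto simp: ext_def)
    obtain m where m: "is_Lsup M eM (Limage S M h F) m"
      using M Lfinite_Limage[OF hM] Lnonempty_Limage[OF hM] sup.hyps
      unfolding Ljoin_semilattice_def by blast
    have "eM m z = sub P K (I z)" if "z \<in> M" for z
    proof -
      have "eM m z = sub S F (\<lambda>K. eM (h K) z)" using m that by (simp add: is_Lsup_Limage_iff[OF hM])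
      also have "\<dots> = sub S F (\<lambda>K. sub P K (I z))"
        using h that by (intro sub_cong) (auto simp: ext_def)
      finally show ?thesis using sup.hyps I[OF that] by simp
    qed
    then show ?case using m by (auto simp: ext_def is_Lsup_def)
  qed
  then obtain g' where g': "\<And>K. K \<in> ?Q \<Longrightarrow> ext K (g' K)" by metis
  define g where "g = restrict g' ?Q"
  have g: "ext K (g K)" if "K \<in> ?Q" for K using g' that by (simp add: g_def)
  then have gM: "g \<in> ?Q \<rightarrow> M" by (auto simp: ext_def)
  have "g (xi P e x) = f x" if "x \<in> P" for x
  proof -
    have "xi P e x \<in> ?Q" using point_hull_in_F_completion[OF C that] by (simp add: xi_def PF_def)
    then show ?thesis
      using g ext_xi[OF that] Lordered_set_eqI[OF ordM] unfolding ext_def by metis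
  qed
  moreover have "Scott_convexity_preserving ?Q (sub P) M eM g"
    unfolding Scott_convexity_preserving_def Lorder_preserving_def
  proof (intro conjI ballI allI impI)
    show "g \<in> ?Q \<rightarrow> M" by (rule gM)
  next
    fix K K' assume K: "K \<in> ?Q" "K' \<in> ?Q"
    then have gK: "g K' \<in> M" using gM by blast
    \<comment> \<open>\<open>K'\<close> is contained in the preimage of the principal ideal of
      \<open>g K'\<close>, so the inclusion degree of \<open>K\<close> in \<open>K'\<close> passes
      to that preimage.\<close>
    then have "sub P K' (I (g K')) = 1"
      using g[OF K(2)] ordM unfolding ext_def Lordered_set_def by metis
    then have "sub P K K' \<le> sub P K (I (g K'))"
      using sub_trans[of P K K' "I (g K')"] by simp
    then show "sub P K K' \<le> eM (g K) (g K')" using g[OF K(1)] gK by (simp add: ext_def)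
  next
    fix F K assume F: "Lnonempty ?Q F \<and> Lfinite ?Q F \<and> is_Lsup ?Q (sub P) F K"
    \<comment> \<open>The test sets used below are the \<open>I z\<close>, which are Scott convex
      but may lie outside \<open>PF P e\<close>; hence the form that tests against all convex
      sets.\<close>
    then have K: "K \<in> ?Q" "\<And>A. A \<in> Scott_Lconvex P e \<Longrightarrow> sub P K A = sub ?Q F (\<lambda>K. sub P K A)"
      using F_completion_Lsup_iff[OF C] by (auto simp: PF_def)
    have "eM (g K) z = sub ?Q F (\<lambda>K. eM (g K) z)" if "z \<in> M" for z
    proof -
      have "eM (g K) z = sub P K (I z)" using g[OF K(1)] that by (simp add: ext_def)
      also have "\<dots> = sub ?Q F (\<lambda>K. sub P K (I z))" by (rule K(2)[OF I[OF that]])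
      also have "\<dots> = sub ?Q F (\<lambda>K. eM (g K) z)"
        using g that by (intro sub_cong) (auto simp: ext_def)
      finally show ?thesis .
    qed
    then show "is_Lsup M eM (Limage ?Q M g F) (g K)"
      using gM K(1) by (auto simp: is_Lsup_Limage_iff)
  qed
  ultimately show ?thesis by (auto simp: g_def)
qed

theorem theorem4p12:
  fixes P :: "'a set" and e :: "'a \<Rightarrow> 'a \<Rightarrow> 'l::complete_residuated_lattice"
  assumes "Lordered_set P e"
  shows "Ljoin_semilattice_completion TYPE('m) P e (PF P e) (sub P) (xi P e)"
  unfolding Ljoin_semilattice_completion_def
proof (intro conjI allI impI)
  show "Ljoin_semilattice (PF P e) (sub P)"
    unfolding PF_def by (rule Ljoin_semilattice_F_completion[OF Scott_Lconvex_is_structure])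
  show "Scott_convexity_preserving P e (PF P e) (sub P) (xi P e)"
    by (rule Scott_convexity_preserving_xi[OF assms])
  fix M :: "'m set" and eM f
  assume Mf: "Ljoin_semilattice M eM \<and> Scott_convexity_preserving P e M eM f"
  then have M: "Lordered_set M eM" by (simp add: Ljoin_semilattice_def)
  show "\<exists>!g. g \<in> extensional (PF P e) \<and> Scott_convexity_preserving (PF P e) (sub P) M eM g \<and>
      (\<forall>x\<in>P. g (xi P e x) = f x)"
  proof (rule ex_ex1I)
    show "\<exists>g. g \<in> extensional (PF P e) \<and> Scott_convexity_preserving (PF P e) (sub P) M eM g \<and>
        (\<forall>x\<in>P. g (xi P e x) = f x)"
      using Scott_convexity_preserving_PF_extension Mf by blast
  next
    fix g h
    assume g: "g \<in> extensional (PF P e) \<and> Scott_convexity_preserving (PF P e) (sub P) M eM g \<and>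
        (\<forall>x\<in>P. g (xi P e x) = f x)"
      and h: "h \<in> extensional (PF P e) \<and> Scott_convexity_preserving (PF P e) (sub P) M eM h \<and>
        (\<forall>x\<in>P. h (xi P e x) = f x)"
    then have "g K = h K" if "K \<in> PF P e" for K
      using Scott_convexity_preserving_PF_unique[OF M _ _ _ that] by simp
    then show "g = h" using g h extensionalityI by blast
  qed
qed

end
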